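(* Let $n,d\ge 1$, let $a_1,\dots,a_n\in\mathbb{R}^d$ with $a_i=(a_{i1},\dots,a_{id})$, let $\omega_1,\dots,\omega_n\ge 0$, and let $\lambda_1\ge\lambda_2\ge\dots\ge\lambda_n\ge 0$. Let $\tau=\frac{r}{s}$ with $r,s\in\mathbb{N}\setminus\{0\}$, $r>s$ and $\gcd(r,s)=1$. Then the ordered median problem $$\min_{x\in\mathbb{R}^d} f_\lambda(x),\qquad f_\lambda(x)=\sum_{i=1}^n\lambda_i\,\omega_{\sigma(i)}\|x-a_{\sigma(i)}\|_\tau ,$$ where $\sigma=\sigma_x$ is a permutation of $\{1,\dots,n\}$ with $\omega_{\sigma(1)}\|x-a_{\sigma(1)}\|_\tau\ge\dots\ge\omega_{\sigma(n)}\|x-a_{\sigma(n)}\|_\tau$, is equivalent to the problem, in the real variables $x\in\mathbb{R}^d$, $v,w,z\in\mathbb{R}^n$, $y,u\in\mathbb{R}^{n\times d}$, $$\begin{array}{lll} \min & \displaystyle\sum_{k=1}^n v_k+\sum_{i=1}^n w_i & \\ \text{s.t.} & v_i+w_k\ge\lambda_k z_i, & i,k=1,\dots,n,\\ & y_{ij}-x_j+a_{ij}\ge 0, & i=1,\dots,n,\ j=1,\dots,d,\\ & y_{ij}+x_j-a_{ij}\ge 0, & i=1,\dots,n,\ j=1,\dots,d,\\ & y_{ij}^r\le u_{ij}^s z_i^{r-s}, & i=1,\dots,n,\ j=1,\dots,d,\\ & \omega_i^{r/s}\sum_{j=1}^d u_{ij}\le z_i, & i=1,\dots,n,\\ & u_{ij}\ge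 0, & i=1,\dots,n,\ j=1,\dots,d. \end{array}$$ Here equivalent means: for every $x\in\mathbb{R}^d$, the infimum of $\sum_k v_k+\sum_i w_i$ over all $(v,w,z,y,u)$ such that $(x,v,w,z,y,u)$ is feasible for the second problem equals $f_\lambda(x)$ (so in particular the two problems have the same optimal value).
   Context: For $\tau\ge1$, $\|x\|_\tau=\big(\sum_{j=1}^d|x_j|^\tau\big)^{1/\tau}$ is the $\ell_\tau$ norm on $\mathbb{R}^d$. The value $f_\lambda(x)$ does not depend on the choice of the sorting permutation $\sigma_x$: it is the sum of the weighted distances $\omega_i\|x-a_i\|_\tau$ sorted in nonincreasing order and multiplied by $\lambda_1,\dots,\lambda_n$. *)

theory Defs
  imports "HOL-Analysis.Analysis" "HOL-Combinatorics.Permutations"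
begin

(* Families indexed by 1,...,n are functions on nat of which only the values on {1..n} matter;
   coordinates 1,...,d are the elements of the finite type 'd. *)

definition lp_norm :: "real \<Rightarrow> real ^ 'd \<Rightarrow> real" where
  "lp_norm \<tau> x = (\<Sum>j\<in>UNIV. \<bar>x $ j\<bar> powr \<tau>) powr (1 / \<tau>)"

definition sorting_perm :: "nat \<Rightarrow> (nat \<Rightarrow> real) \<Rightarrow> (nat \<Rightarrow> nat) \<Rightarrow> bool" where
  "sorting_perm n g \<sigma> \<longleftrightarrow> \<sigma> permutes {1..n} \<and>
     (\<forall>i\<in>{1..n}. \<forall>j\<in>{1..n}. i \<le> j \<longrightarrow> g (\<sigma> j) \<le> g (\<sigma> i))"

(* Quantifying over sorting permutations is never vacuous. *)
lemma sorting_perm_exists: "\<exists>\<sigma>. sorting_perm n g \<sigma>"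
proof -
  define xs where "xs = sort_key (\<lambda>i. - g i) [1..<Suc n]"
  define \<sigma> where "\<sigma> i = (if i \<in> {1..n} then xs ! (i - 1) else i)" for i
  have len: "length xs = n" and st: "set xs = {1..n}" and di: "distinct xs"
    by (auto simp: xs_def)
  have so: "sorted (map (\<lambda>i. - g i) xs)"
    by (simp add: xs_def)
  have "inj_on \<sigma> {1..n}"
  proof (rule inj_onI)
    fix i j assume ij: "i \<in> {1..n}" "j \<in> {1..n}" and "\<sigma> i = \<sigma> j"
    then have "i - 1 = j - 1"
      using di len by (auto simp: \<sigma>_def nth_eq_iff_index_eq)
    then show "i = j" using ij by auto
  qed
  moreover have "\<sigma> ` {1..n} \<subseteq> {1..n}"
  proof
    fix k assume "k \<in> \<sigma> ` {1..n}"
    then obtain i where i: "i \<in> {1..n}" "k = xs ! (i - 1)" by (auto simp: \<sigma>_def)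
    then have "k \<in> set xs" using len by auto
    then show "k \<in> {1..n}" using st by simp
  qed
  ultimately have "bij_betw \<sigma> {1..n} {1..n}"
    unfolding bij_betw_def using endo_inj_surj[of "{1..n}" \<sigma>] by blast
  then have "\<sigma> permutes {1..n}"
    by (rule bij_imp_permutes) (auto simp add: \<sigma>_def)
  moreover have "g (\<sigma> j) \<le> g (\<sigma> i)" if "i \<in> {1..n}" "j \<in> {1..n}" "i \<le> j" for i j
    using sorted_nth_mono[OF so, of "i - 1" "j - 1"] that len by (auto simp: \<sigma>_def)
  ultimately show ?thesis unfolding sorting_perm_def by blast
qed

definition ordered_median ::
  "nat \<Rightarrow> (nat \<Rightarrow> real) \<Rightarrow> (nat \<Rightarrow> real) \<Rightarrow> real \<Rightarrow> (nat \<Rightarrow> real ^ 'd)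
     \<Rightarrow> (nat \<Rightarrow> nat) \<Rightarrow> real ^ 'd \<Rightarrow> real" where
  "ordered_median n lam \<omega> \<tau> a \<sigma> x =
     (\<Sum>i\<in>{1..n}. lam i * \<omega> (\<sigma> i) * lp_norm \<tau> (x - a (\<sigma> i)))"

definition feasible ::
  "nat \<Rightarrow> (nat \<Rightarrow> real) \<Rightarrow> (nat \<Rightarrow> real) \<Rightarrow> nat \<Rightarrow> nat \<Rightarrow> (nat \<Rightarrow> real ^ 'd) \<Rightarrow> real ^ 'd
     \<Rightarrow> (nat \<Rightarrow> real) \<Rightarrow> (nat \<Rightarrow> real) \<Rightarrow> (nat \<Rightarrow> real)
     \<Rightarrow> (nat \<Rightarrow> real ^ 'd) \<Rightarrow> (nat \<Rightarrow> real ^ 'd) \<Rightarrow> bool" where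
  "feasible n lam \<omega> r s a x v w z y u \<longleftrightarrow>
     (\<forall>i\<in>{1..n}. \<forall>k\<in>{1..n}. v i + w k \<ge> lam k * z i) \<and>
     (\<forall>i\<in>{1..n}. \<forall>j. y i $ j - x $ j + a i $ j \<ge> 0) \<and>
     (\<forall>i\<in>{1..n}. \<forall>j. y i $ j + x $ j - a i $ j \<ge> 0) \<and>
     (\<forall>i\<in>{1..n}. \<forall>j. (y i $ j) ^ r \<le> (u i $ j) ^ s * (z i) ^ (r - s)) \<and>
     (\<forall>i\<in>{1..n}. \<omega> i powr (real r / real s) * (\<Sum>j\<in>UNIV. u i $ j) \<le> z i) \<and>
     (\<forall>i\<in>{1..n}. \<forall>j. u i $ j \<ge> 0)"

definition objective :: "nat \<Rightarrow> (nat \<Rightarrow> real) \<Rightarrow> (nat \<Rightarrow> real) \<Rightarrow> real" where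
  "objective n v w = (\<Sum>k\<in>{1..n}. v k) + (\<Sum>i\<in>{1..n}. w i)"

end

(* The lower bound is weak duality: pairing the constraints v_i + w_k >= lambda_k z_i along the
   sorting permutation bounds the objective by sum_k lambda_k z_sigma(k), and the remaining
   constraints say that z_i >= omega_i ||x - a_i||_tau.  Conversely, enlarge all the weighted
   distances by the same e > 0 to get z, which keeps their order; since the identity pairing of two
   sorted sequences is an optimal assignment, an explicit dual solution (v, w) has value
   sum_k lambda_k z_sigma(k).  Let e tend to 0. *)

theory Submission imports Defs begin

section \<open>Real powers and the weighted norm constraints\<close>

lemma power_powr_eq:
  fixes t :: real
  assumes "0 \<le> t" "0 < m"
  shows "(t ^ m) powr b = t powr (real m * b)"
proof (cases "t = 0")
  case True
  with assms show ?thesis by simp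
next
  case False
  with assms have "t ^ m = t powr real m"
    by (simp add: powr_realpow)
  then show ?thesis by (simp add: powr_powr)
qed

lemma lp_norm_nonneg: "0 \<le> lp_norm \<tau> x"
  by (simp add: lp_norm_def)

lemma lp_norm_powr:
  assumes "0 < \<tau>"
  shows "lp_norm \<tau> x powr \<tau> = (\<Sum>j\<in>UNIV. \<bar>x $ j\<bar> powr \<tau>)"
  using assms by (simp add: lp_norm_def powr_powr sum_nonneg)

text \<open>For \<open>z = 0\<close> the bound \<open>y ^ r \<le> u ^ s * z ^ (r - s)\<close> forces every
  coordinate to vanish because \<open>r > s\<close>.\<close>

lemma weighted_lp_norm_le:
  fixes b y u :: "real ^ 'd" and r s :: nat
  assumes "0 < s" "s < r" and \<tau>: "\<tau> = real r / real s" and "0 \<le> \<omega>"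
    and y: "\<And>j. \<bar>b $ j\<bar> \<le> y $ j"
    and yu: "\<And>j. (y $ j) ^ r \<le> (u $ j) ^ s * z ^ (r - s)"
    and uz: "\<omega> powr \<tau> * (\<Sum>j\<in>UNIV. u $ j) \<le> z"
    and u: "\<And>j. 0 \<le> u $ j"
  shows "\<omega> * lp_norm \<tau> b \<le> z"
proof -
  have "1 < \<tau>" using assms by simp
  have "0 \<le> \<omega> powr \<tau> * (\<Sum>j\<in>UNIV. u $ j)" using u by (simp add: sum_nonneg)
  then have "0 \<le> z" using uz by linarith
  have b_pow: "\<bar>b $ j\<bar> ^ r \<le> (u $ j) ^ s * z ^ (r - s)" for j
    using power_mono[OF y[of j], of r] yu[of j] by simp
  show ?thesis
  proof (cases "z = 0")
    case True
    have "b $ j = 0" for j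
      using b_pow[of j] True assms(2) by (auto simp add: zero_power power_le_zero_eq)
    with \<open>1 < \<tau>\<close> True show ?thesis by (simp add: lp_norm_def)
  next
    case False
    then have "0 < z" using \<open>0 \<le> z\<close> by simp
    \<comment> \<open>Taking s-th roots makes the constraint linear in \<open>u\<close>, because
      \<open>r / s = \<tau>\<close> and \<open>(r - s) / s = \<tau> - 1\<close>; summing over the
      coordinates then brings in \<open>uz\<close>.\<close>
    have bj: "\<bar>b $ j\<bar> powr \<tau> \<le> u $ j * z powr (\<tau> - 1)" for j
    proof -
      have "\<bar>b $ j\<bar> powr \<tau> = (\<bar>b $ j\<bar> ^ r) powr (1 / real s)"
        using assms by (simp add: power_powr_eq)
      also have "\<dots> \<le> ((u $ j) ^ s * z ^ (r - s)) powr (1 / real s)"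
        by (rule powr_mono2) (use b_pow in auto)
      also have "\<dots> = ((u $ j) ^ s) powr (1 / real s) * (z ^ (r - s)) powr (1 / real s)"
        using u \<open>0 < z\<close> by (simp add: powr_mult)
      also have "\<dots> = u $ j * z powr (\<tau> - 1)"
        using assms \<open>0 < z\<close> by (simp add: power_powr_eq of_nat_diff diff_divide_distrib)
      finally show ?thesis .
    qed
    have "(\<omega> * lp_norm \<tau> b) powr \<tau> = \<omega> powr \<tau> * (\<Sum>j\<in>UNIV. \<bar>b $ j\<bar> powr \<tau>)"
      using \<open>0 \<le> \<omega>\<close> \<open>1 < \<tau>\<close> by (simp add: powr_mult lp_norm_nonneg lp_norm_powr)
    also have "\<dots> \<le> \<omega> powr \<tau> * (\<Sum>j\<in>UNIV. u $ j * z powr (\<tau> - 1))"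
      by (intro mult_left_mono sum_mono bj) simp
    also have "\<dots> = (\<omega> powr \<tau> * (\<Sum>j\<in>UNIV. u $ j)) * z powr (\<tau> - 1)"
      by (simp add: sum_distrib_right)
    also have "\<dots> \<le> z * z powr (\<tau> - 1)"
      using uz by (simp add: mult_right_mono)
    also have "\<dots> = z powr \<tau>"
      using \<open>0 < z\<close> by (simp add: powr_diff)
    finally have "(\<omega> * lp_norm \<tau> b) powr \<tau> \<le> z powr \<tau>" .
    then show ?thesis
      using powr_less_mono2[of \<tau> z "\<omega> * lp_norm \<tau> b"] \<open>1 < \<tau>\<close> \<open>0 < z\<close>
      by (meson less_le_trans not_less less_imp_le order.strict_trans zero_less_one)
  qed
qed

text \<open>Positivity of \<open>z\<close> allows solving the power constraint for \<open>u\<close>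
  with equality; multiplied by \<open>z powr (\<tau> - 1)\<close>, the sum constraint then becomes
  \<open>(\<omega> * lp_norm \<tau> b) powr \<tau> \<le> z powr \<tau>\<close>.\<close>

lemma weighted_lp_norm_witness:
  fixes b :: "real ^ 'd" and r s :: nat
  assumes "0 < s" "s < r" and \<tau>: "\<tau> = real r / real s" and "0 \<le> \<omega>"
    and "0 < z" and z: "\<omega> * lp_norm \<tau> b \<le> z"
  obtains u :: "real ^ 'd" where
    "\<And>j. \<bar>b $ j\<bar> ^ r \<le> (u $ j) ^ s * z ^ (r - s)"
    "\<omega> powr \<tau> * (\<Sum>j\<in>UNIV. u $ j) \<le> z"
    "\<And>j. 0 \<le> u $ j"
proof
  define u :: "real ^ 'd" where "u = (\<chi> j. \<bar>b $ j\<bar> powr \<tau> / z powr (\<tau> - 1))"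
  have "1 < \<tau>" using assms by simp
  show "0 \<le> u $ j" for j by (simp add: u_def)
  show "\<bar>b $ j\<bar> ^ r \<le> (u $ j) ^ s * z ^ (r - s)" for j
  proof -
    have bs: "(\<bar>b $ j\<bar> powr \<tau>) ^ s = \<bar>b $ j\<bar> ^ r"
    proof (cases "b $ j = 0")
      case True
      with assms show ?thesis by (simp add: zero_power)
    next
      case False
      with assms show ?thesis by (simp add: powr_powr flip: powr_realpow)
    qed
    have "(z powr (\<tau> - 1)) ^ s = z powr (real r - real s)"
      using assms by (simp add: powr_powr left_diff_distrib flip: powr_realpow)
    also have "\<dots> = z ^ (r - s)"
      using assms by (simp add: of_nat_diff flip: powr_realpow)
    finally show ?thesis
      using bs \<open>0 < z\<close> by (simp add: u_def power_divide)
  qed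
  have "\<omega> powr \<tau> * (\<Sum>j\<in>UNIV. u $ j) = (\<omega> * lp_norm \<tau> b) powr \<tau> / z powr (\<tau> - 1)"
    using \<open>0 \<le> \<omega>\<close> \<open>1 < \<tau>\<close>
    by (simp add: u_def powr_mult lp_norm_nonneg lp_norm_powr flip: sum_divide_distrib)
  also have "\<dots> \<le> z powr \<tau> / z powr (\<tau> - 1)"
    using z \<open>0 \<le> \<omega>\<close> \<open>1 < \<tau>\<close>
    by (intro divide_right_mono powr_mono2) (auto simp: lp_norm_nonneg)
  also have "\<dots> = z"
    using \<open>0 < z\<close> by (simp add: powr_diff)
  finally show "\<omega> powr \<tau> * (\<Sum>j\<in>UNIV. u $ j) \<le> z" .
qed

section \<open>Optimal assignment of sorted sequences\<close>

text \<open>The potential is a discrete integral of \<open>lam\<close> against \<open>c\<close>, so the claim is the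
  subgradient inequality for a convex function whose slope at \<open>c k\<close> is \<open>lam k\<close>.\<close>

lemma sorted_potential:
  fixes c lam :: "nat \<Rightarrow> real"
  assumes lam: "\<forall>i\<in>{1..n}. \<forall>j\<in>{1..n}. i \<le> j \<longrightarrow> lam j \<le> lam i"
    and c: "\<forall>i\<in>{1..n}. \<forall>j\<in>{1..n}. i \<le> j \<longrightarrow> c j \<le> c i"
  obtains V :: "nat \<Rightarrow> real"
  where "\<And>i k. i \<in> {1..n} \<Longrightarrow> k \<in> {1..n} \<Longrightarrow> lam k * (c i - c k) \<le> V i - V k"
proof
  \<comment> \<open>On the segment from \<open>c (Suc i)\<close> to \<open>c i\<close> the slope is
    \<open>lam i\<close>. The term at index 0 lies outside the sorted range but cancels in
    differences between positive indices.\<close>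
  define V where "V i = - (\<Sum>m<i. lam m * (c m - c (Suc m)))" for i
  have V_Suc: "V (Suc i) = V i - lam i * (c i - c (Suc i))" for i
    by (simp add: V_def)
  fix i k assume ik: "i \<in> {1..n}" "k \<in> {1..n}"
  show "lam k * (c i - c k) \<le> V i - V k"
  proof (cases "i \<le> k")
    case True
    then show ?thesis using ik(2)
    proof (induction k rule: dec_induct)
      case base
      show ?case by simp
    next
      case (step k)
      \<comment> \<open>Since \<open>c i - c (Suc k)\<close> is nonnegative, the larger slope
        \<open>lam k\<close> may replace \<open>lam (Suc k)\<close>; the new segment is then matched
        exactly by the increment of \<open>V\<close>.\<close>
      have "lam (Suc k) * (c i - c (Suc k)) \<le> lam k * (c i - c (Suc k))"
        using lam c step.hyps step.prems ik by (intro mult_right_mono) auto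
      also have "\<dots> = lam k * (c i - c k) + lam k * (c k - c (Suc k))"
        by (simp add: algebra_simps)
      also have "\<dots> \<le> V i - V (Suc k)"
        using step ik by (simp add: V_Suc)
      finally show ?case .
    qed
  next
    case False
    then have "k \<le> i" by simp
    then show ?thesis using ik(1)
    proof (induction i rule: dec_induct)
      case base
      show ?case by simp
    next
      case (step i)
      \<comment> \<open>The left side falls by \<open>lam k\<close> times the gap, \<open>V\<close>
        only by \<open>lam i\<close> times it.\<close>
      have "lam i * (c i - c (Suc i)) \<le> lam k * (c i - c (Suc i))"
        using lam c step.hyps step.prems ik by (intro mult_right_mono) auto
      moreover have "lam k * (c i - c k) \<le> V i - V k"
        using step ik by simp
      moreover have "lam k * (c (Suc i) - c k) = lam k * (c i - c k) - lam k * (c i - c (Suc i))"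
        by (simp add: algebra_simps)
      ultimately show ?case
        unfolding V_Suc by linarith
    qed
  qed
qed

text \<open>The potential prices the sorted positions. Choosing \<open>w\<close> to make each pair
  (\<open>\<sigma> k\<close>, \<open>k\<close>) tight cancels \<open>V\<close> from the objective,
  and the potential inequality is exactly feasibility for all other pairs.\<close>

lemma sorted_assignment_dual:
  assumes lam: "\<forall>i\<in>{1..n}. \<forall>j\<in>{1..n}. i \<le> j \<longrightarrow> lam j \<le> lam i"
    and \<sigma>: "sorting_perm n z \<sigma>"
  obtains v w where
    "\<And>i k. i \<in> {1..n} \<Longrightarrow> k \<in> {1..n} \<Longrightarrow> lam k * z i \<le> v i + w k"
    "objective n v w = (\<Sum>k\<in>{1..n}. lam k * z (\<sigma> k))"
proof -
  have perm: "\<sigma> permutes {1..n}" using \<sigma> by (simp add: sorting_perm_def)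
  have dec: "\<forall>i\<in>{1..n}. \<forall>j\<in>{1..n}. i \<le> j \<longrightarrow> z (\<sigma> j) \<le> z (\<sigma> i)"
    using \<sigma> by (simp add: sorting_perm_def)
  obtain V where V: "lam k * (z (\<sigma> i) - z (\<sigma> k)) \<le> V i - V k"
    if "i \<in> {1..n}" "k \<in> {1..n}" for i k
    by (rule sorted_potential[OF lam dec]) blast
  \<comment> \<open>\<open>inv \<sigma> i\<close> is the position of \<open>i\<close> in the sorted
    order.\<close>
  define v where "v i = V (inv \<sigma> i)" for i
  define w where "w k = lam k * z (\<sigma> k) - V k" for k
  have v\<sigma>: "v (\<sigma> i) = V i" for i
    by (simp add: v_def permutes_inverses[OF perm])
  show thesis
  proof
    fix i k assume ik: "i \<in> {1..n}" "k \<in> {1..n}"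
    have "inv \<sigma> i \<in> {1..n}"
      using permutes_in_image[OF permutes_inv[OF perm]] ik(1) by blast
    from V[OF this ik(2)] show "lam k * z i \<le> v i + w k"
      by (simp add: v_def w_def permutes_inverses[OF perm] algebra_simps)
  next
    have "(\<Sum>k\<in>{1..n}. v k) = (\<Sum>k\<in>{1..n}. V k)"
      using sum.permute[OF perm, of v] by (simp add: comp_def v\<sigma>)
    then show "objective n v w = (\<Sum>k\<in>{1..n}. lam k * z (\<sigma> k))"
      by (simp add: objective_def w_def sum_subtractf)
  qed
qed

section \<open>Lower bound and approximation for fixed \<open>x\<close>\<close>

lemma feasible_objective_ge:
  assumes \<omega>: "\<forall>i\<in>{1..n}. \<omega> i \<ge> 0"
    and lam: "\<forall>i\<in>{1..n}. lam i \<ge> 0"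
    and rs: "0 < s" "s < r" "\<tau> = real r / real s"
    and perm: "\<sigma> permutes {1..n}"
    and feas: "feasible n lam \<omega> r s a x v w z y u"
  shows "ordered_median n lam \<omega> \<tau> a \<sigma> x \<le> objective n v w"
proof -
  have \<sigma>: "\<sigma> k \<in> {1..n}" if "k \<in> {1..n}" for k
    using permutes_in_image[OF perm] that by blast
  have le: "\<omega> i * lp_norm \<tau> (x - a i) \<le> z i" if i: "i \<in> {1..n}" for i
  proof (rule weighted_lp_norm_le[OF rs, where y = "y i" and u = "u i"])
    show "\<bar>(x - a i) $ j\<bar> \<le> y i $ j" for j
    proof -
      have "y i $ j - x $ j + a i $ j \<ge> 0" "y i $ j + x $ j - a i $ j \<ge> 0"
        using feas i unfolding feasible_def by blast+
      then show ?thesis by simp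
    qed
  qed (use feas i \<omega> rs in \<open>auto simp: feasible_def\<close>)
  \<comment> \<open>The pairing of \<open>\<sigma> k\<close> with \<open>k\<close> uses every
    \<open>v\<close> and every \<open>w\<close> exactly once, so the right side is a reordering of
    the objective.\<close>
  have "ordered_median n lam \<omega> \<tau> a \<sigma> x \<le> (\<Sum>k\<in>{1..n}. v (\<sigma> k) + w k)"
    unfolding ordered_median_def
  proof (rule sum_mono)
    fix k assume k: "k \<in> {1..n}"
    have "lam k * \<omega> (\<sigma> k) * lp_norm \<tau> (x - a (\<sigma> k)) \<le> lam k * z (\<sigma> k)"
      using mult_left_mono[OF le[OF \<sigma>[OF k]], of "lam k"] lam k by (simp add: mult.assoc)
    also have "\<dots> \<le> v (\<sigma> k) + w k"
      using feas \<sigma>[OF k] k by (simp add: feasible_def)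
    finally show "lam k * \<omega> (\<sigma> k) * lp_norm \<tau> (x - a (\<sigma> k)) \<le> v (\<sigma> k) + w k" .
  qed
  also have "\<dots> = objective n v w"
    using sum.permute[OF perm, of v] by (simp add: objective_def sum.distrib comp_def)
  finally show ?thesis .
qed

text \<open>The slack \<open>e\<close> cannot be dropped: if \<open>\<omega> i = 0\<close> and \<open>x \<noteq> a i\<close>, every feasible \<open>z i\<close> is
  positive, so the infimum need not be attained.\<close>

lemma feasible_objective_approx:
  assumes \<omega>: "\<forall>i\<in>{1..n}. \<omega> i \<ge> 0"
    and lam: "\<forall>i\<in>{1..n}. \<forall>j\<in>{1..n}. i \<le> j \<longrightarrow> lam j \<le> lam i"
    and rs: "0 < s" "s < r" "\<tau> = real r / real s"
    and \<sigma>: "sorting_perm n (\<lambda>i. \<omega> i * lp_norm \<tau> (x - a i)) \<sigma>"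
    and "0 < e"
  obtains v w z y u where "feasible n lam \<omega> r s a x v w z y u"
    "objective n v w = ordered_median n lam \<omega> \<tau> a \<sigma> x + e * (\<Sum>k\<in>{1..n}. lam k)"
proof -
  \<comment> \<open>The uniform shift makes \<open>z\<close> strictly positive, as the construction
    of \<open>u\<close> requires.\<close>
  define z where "z i = \<omega> i * lp_norm \<tau> (x - a i) + e" for i
  have "sorting_perm n z \<sigma>" using \<sigma> by (simp add: sorting_perm_def z_def)
  from sorted_assignment_dual[OF lam this] obtain v w where
    vw: "\<And>i k. i \<in> {1..n} \<Longrightarrow> k \<in> {1..n} \<Longrightarrow> lam k * z i \<le> v i + w k"
    and obj: "objective n v w = (\<Sum>k\<in>{1..n}. lam k * z (\<sigma> k))" by blast
  have "\<exists>u. (\<forall>j. \<bar>(x - a i) $ j\<bar> ^ r \<le> (u $ j) ^ s * z i ^ (r - s)) \<and>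
      \<omega> i powr \<tau> * (\<Sum>j\<in>UNIV. u $ j) \<le> z i \<and> (\<forall>j. 0 \<le> u $ j)" if "i \<in> {1..n}" for i
  proof -
    have "0 \<le> \<omega> i" using \<omega> that by blast
    moreover from this have "0 < z i"
      using \<open>0 < e\<close> by (simp add: z_def add_nonneg_pos lp_norm_nonneg)
    moreover have "\<omega> i * lp_norm \<tau> (x - a i) \<le> z i" using \<open>0 < e\<close> by (simp add: z_def)
    ultimately show ?thesis using weighted_lp_norm_witness[OF rs] by metis
  qed
  then obtain u where u: "\<And>i. i \<in> {1..n} \<Longrightarrow>
      (\<forall>j. \<bar>(x - a i) $ j\<bar> ^ r \<le> (u i $ j) ^ s * z i ^ (r - s)) \<and>
      \<omega> i powr \<tau> * (\<Sum>j\<in>UNIV. u i $ j) \<le> z i \<and> (\<forall>j. 0 \<le> u i $ j)"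
    by metis
  show thesis
  proof
    \<comment> \<open>This \<open>y\<close> is the least one its two linear constraints allow, so
      the power constraint is weakest.\<close>
    show "feasible n lam \<omega> r s a x v w z (\<lambda>i. \<chi> j. \<bar>(x - a i) $ j\<bar>) u"
      unfolding feasible_def using vw u by (auto simp: rs(3))
    show "objective n v w = ordered_median n lam \<omega> \<tau> a \<sigma> x + e * (\<Sum>k\<in>{1..n}. lam k)"
      by (simp add: obj ordered_median_def z_def distrib_left sum.distrib sum_distrib_left
          mult.assoc mult.commute[of e])
  qed
qed

section \<open>Passage to infima\<close>

lemma Inf_UN:
  fixes S :: "'b \<Rightarrow> 'a::complete_lattice set"
  shows "Inf (\<Union>x\<in>A. S x) = (INF x\<in>A. Inf (S x))"
  by (intro antisym INF_greatest Inf_superset_mono Inf_greatest)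
    (auto intro: INF_lower2 Inf_lower)

lemma Inf_feasible_eq:
  assumes \<omega>: "\<forall>i\<in>{1..n}. \<omega> i \<ge> 0"
    and mono: "\<forall>i\<in>{1..n}. \<forall>j\<in>{1..n}. i \<le> j \<longrightarrow> lam j \<le> lam i"
    and lam: "\<forall>i\<in>{1..n}. lam i \<ge> 0"
    and rs: "0 < s" "s < r" "\<tau> = real r / real s"
    and \<sigma>: "sorting_perm n (\<lambda>i. \<omega> i * lp_norm \<tau> (x - a i)) \<sigma>"
  shows "Inf {ereal (objective n v w) | v w z y u. feasible n lam \<omega> r s a x v w z y u}
    = ereal (ordered_median n lam \<omega> \<tau> a \<sigma> x)" (is "Inf ?S = ereal ?f")
proof (rule antisym)
  show "ereal ?f \<le> Inf ?S"
  proof (rule Inf_greatest)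
    fix t assume "t \<in> ?S"
    then obtain v w z y u where "t = ereal (objective n v w)"
      "feasible n lam \<omega> r s a x v w z y u" by blast
    with \<sigma> show "ereal ?f \<le> t"
      using feasible_objective_ge[OF \<omega> lam rs] by (auto simp only: sorting_perm_def ereal_less_eq)
  qed
  let ?L = "\<Sum>k\<in>{1..n}. lam k"
  have "0 \<le> ?L" using lam by (intro sum_nonneg) blast
  show "Inf ?S \<le> ereal ?f"
  proof (rule ereal_le_epsilon2)
    fix e :: real assume "0 < e"
    \<comment> \<open>Adding 1 keeps the denominator positive when all \<open>lam\<close> vanish,
      and the total excess stays at most \<open>e\<close>.\<close>
    then have "0 < e / (?L + 1)" using \<open>0 \<le> ?L\<close> by simp
    from feasible_objective_approx[OF \<omega> mono rs \<sigma> this] obtain v w z y u where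
      feas: "feasible n lam \<omega> r s a x v w z y u"
      and obj: "objective n v w = ?f + e / (?L + 1) * ?L" by blast
    have "Inf ?S \<le> ereal (objective n v w)"
      by (rule Inf_lower) (use feas in blast)
    also have "e / (?L + 1) * ?L \<le> e"
      using \<open>0 < e\<close> \<open>0 \<le> ?L\<close> by (simp add: divide_simps)
    then have "ereal (objective n v w) \<le> ereal ?f + ereal e"
      by (simp add: obj)
    finally show "Inf ?S \<le> ereal ?f + ereal e" .
  qed
qed

theorem mainTheorem1:
  fixes n r s :: nat and a :: "nat \<Rightarrow> real ^ 'd" and \<omega> lam :: "nat \<Rightarrow> real" and \<tau> :: real
    and \<sigma> :: "real ^ 'd \<Rightarrow> nat \<Rightarrow> nat"
  assumes "n \<ge> 1"
    and "\<forall>i\<in>{1..n}. \<omega> i \<ge> 0"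
    and "\<forall>i\<in>{1..n}. \<forall>j\<in>{1..n}. i \<le> j \<longrightarrow> lam j \<le> lam i"
    and "\<forall>i\<in>{1..n}. lam i \<ge> 0"
    and "s \<ge> 1" and "r > s" and "gcd r s = 1"
    and "\<tau> = real r / real s"
    and "\<forall>x. sorting_perm n (\<lambda>i. \<omega> i * lp_norm \<tau> (x - a i)) (\<sigma> x)"
  shows "(\<forall>x. Inf {ereal (objective n v w) | v w z y u. feasible n lam \<omega> r s a x v w z y u}
              = ereal (ordered_median n lam \<omega> \<tau> a (\<sigma> x) x)) \<and>
         Inf {ereal (objective n v w) | x v w z y u. feasible n lam \<omega> r s a x v w z y u}
           = (INF x. ereal (ordered_median n lam \<omega> \<tau> a (\<sigma> x) x))"
proof -
  let ?S = "\<lambda>x. {ereal (objective n v w) | v w z y u. feasible n lam \<omega> r s a x v w z y u}"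
  have eq: "Inf (?S x) = ereal (ordered_median n lam \<omega> \<tau> a (\<sigma> x) x)" for x
    by (rule Inf_feasible_eq) (use assms in auto)
  \<comment> \<open>Slicing the joint feasible set by \<open>x\<close> turns the joint infimum into
    an iterated one.\<close>
  have "{ereal (objective n v w) | x v w z y u. feasible n lam \<omega> r s a x v w z y u} = (\<Union>x. ?S x)"
    by blast
  moreover have "Inf (\<Union>x. ?S x) = (INF x. Inf (?S x))"
    by (rule Inf_UN)
  ultimately show ?thesis using eq by simp
qed

end
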